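(* Assume the weak Kurepa Hypothesis (wKH), i.e. that there exists a weak Kurepa tree. Then there exists a regular Hausdorff $P$-space of cardinality $\omega_2$ which is not weakly Whyburn.
   Context: A weak Kurepa tree is a tree of cardinality $\omega_1$ with $\omega_2$-many (that is, at least $\omega_2$) uncountable branches. A $P$-space is a topological space in which every $G_\delta$ set is open. A set $F\subseteq X$ is an almost closed set converging to $x\in X$, written $F\to x$, if $\overline{F}\setminus F=\{x\}$. A space $X$ is weakly Whyburn if for each non-closed set $A\subseteq X$ there are a point $x\in\overline{A}\setminus A$ and a set $F\subseteq A$ with $F\to x$. *)

theory Defs
  imports "HOL-Analysis.Analysis"
begin

unbundle cardinal_syntax

abbreviation omega1 :: "nat set rel"
  where "omega1 \<equiv> cardSuc natLeq"

abbreviation omega2 :: "nat set set rel"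
  where "omega2 \<equiv> cardSuc omega1"

text \<open>Trees are given by a carrier and a reflexive order \<open>r\<close> on it; several minimal
  elements are allowed.\<close>

definition tree_order :: "'a set \<Rightarrow> 'a rel \<Rightarrow> bool"
  where "tree_order T r \<longleftrightarrow>
    partial_order_on T r \<and>
    (\<forall>t\<in>T. well_order_on (underS r t) (Restr r (underS r t)))"

definition tree_branch :: "'a set \<Rightarrow> 'a rel \<Rightarrow> 'a set \<Rightarrow> bool"
  where "tree_branch T r b \<longleftrightarrow> pred_on.maxchain T (\<lambda>s t. (s, t) \<in> r) b"

text \<open>As usual in the context of Kurepa trees, the tree has height \<open>\<omega>\<^sub>1\<close>: the second conjunct
  says that every node has countable height, and so the uncountable branches are exactly the
  branches of order type \<open>\<omega>\<^sub>1\<close>.  Without it the notion would degenerate: if the continuum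
  hypothesis fails, then a chain of type \<open>\<omega>\<^sub>1\<close> with the full binary tree of height \<open>\<omega>\<close> on top
  has cardinality \<open>\<omega>\<^sub>1\<close> and at least \<open>\<omega>\<^sub>2\<close> uncountable maximal chains;
  under the continuum hypothesis the countable-length binary sequences form a weak Kurepa tree
  anyway, so that the weak Kurepa Hypothesis would be a theorem of ZFC.\<close>

definition weak_Kurepa_tree :: "'a set \<Rightarrow> 'a rel \<Rightarrow> bool"
  where "weak_Kurepa_tree T r \<longleftrightarrow>
    tree_order T r \<and>
    (\<forall>t\<in>T. countable (underS r t)) \<and>
    |T| =o omega1 \<and>
    omega2 \<le>o |{b. tree_branch T r b \<and> uncountable b}|"

definition P_space :: "'a topology \<Rightarrow> bool"
  where "P_space X \<longleftrightarrow> (\<forall>S. gdelta_in X S \<longrightarrow> openin X S)"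

definition almost_closed_converging :: "'a topology \<Rightarrow> 'a set \<Rightarrow> 'a \<Rightarrow> bool"
  where "almost_closed_converging X F x \<longleftrightarrow>
    F \<subseteq> topspace X \<and> x \<in> topspace X \<and> X closure_of F - F = {x}"

definition weakly_Whyburn :: "'a topology \<Rightarrow> bool"
  where "weakly_Whyburn X \<longleftrightarrow>
    (\<forall>A. A \<subseteq> topspace X \<and> \<not> closedin X A \<longrightarrow>
      (\<exists>x \<in> X closure_of A - A. \<exists>F. F \<subseteq> A \<and> almost_closed_converging X F x))"

end

theory Submission
  imports Defs "HOL-Library.Countable_Set_Type"
begin

text \<open>
  The space is a variant of the Alexandroff duplicate of a set of \<open>\<omega>\<^sub>2\<close> uncountable branches.
  One copy of the branches consists of isolated points; the other copy, \<open>Y\<close>, carries the topology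
  of the tree, and a neighbourhood of \<open>y \<in> Y\<close> contains all but at most \<open>\<omega>\<^sub>1\<close> of the isolated points
  whose branch passes through some fixed node of the branch of \<open>y\<close>.  A set of at most \<open>\<omega>\<^sub>1\<close>
  isolated points is closed.  A larger set \<open>F\<close> of isolated points has more than one limit point:
  as there are only \<open>\<omega>\<^sub>1\<close> nodes, all but \<open>\<omega>\<^sub>1\<close> many elements of \<open>F\<close> have a branch each of whose nodes
  is met by more than \<open>\<omega>\<^sub>1\<close> elements of \<open>F\<close>.  Hence no set of isolated points is almost closed.
\<close>

section \<open>Sets of size at most \<open>omega1\<close>\<close>

lemma Card_order_omega1: "Card_order omega1"
  by (simp add: cardSuc_Card_order natLeq_Card_order)

lemma infinite_Field_omega1: "infinite (Field omega1)"
  using Cinfinite_cardSuc[OF natLeq_Cinfinite] by (simp add: cinfinite_def)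

lemma UN_ordLeq_omega1:
  assumes "|I| \<le>o omega1" "\<And>i. i \<in> I \<Longrightarrow> |A i| \<le>o omega1"
  shows "|\<Union>i\<in>I. A i| \<le>o omega1"
  using assms card_of_UNION_ordLeq_infinite_Field[OF infinite_Field_omega1 Card_order_omega1]
  by blast

lemma subset_ordLeq_omega1: "A \<subseteq> B \<Longrightarrow> |B| \<le>o omega1 \<Longrightarrow> |A| \<le>o omega1"
  using card_of_mono1 ordLeq_transitive by blast

lemma countable_ordLeq_omega1:
  assumes "countable A"
  shows "|A| \<le>o omega1"
proof -
  have "|A| \<le>o natLeq"
    using assms by (simp add: countable_card_le_natLeq)
  then show ?thesis
    using cardSuc_ordLeq[OF natLeq_Card_order] ordLeq_transitive by blast
qed

lemma Un_ordLeq_omega1: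
  assumes "|A| \<le>o omega1" "|B| \<le>o omega1"
  shows "|A \<union> B| \<le>o omega1"
proof -
  have "|\<Union>C\<in>{A, B}. C| \<le>o omega1"
    by (rule UN_ordLeq_omega1) (use assms countable_ordLeq_omega1[of "{A, B}"] in auto)
  then show ?thesis by simp
qed

text \<open>Both copies of the branches live in one set \<open>X\<close>: \<open>Y\<close> holds the
  limit points, \<open>X - Y\<close> the isolated ones, and \<open>f\<close> gives the branch of a
  point. What the topology needs of the tree is kept in \<open>bounded\<close> (countably many nodes
  of an uncountable branch lie below one of its nodes) and \<open>separated\<close> (branches are
  maximal chains).\<close>

locale branch_duplicate =
  fixes X Y :: "'x set" and T :: "'n set" and f :: "'x \<Rightarrow> 'n set"
  assumes Y_subset: "Y \<subseteq> X"
    and card_nodes: "|T| \<le>o omega1"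
    and f_subset: "x \<in> X \<Longrightarrow> f x \<subseteq> T"
    and bounded: "\<lbrakk>y \<in> Y; countable S; S \<subseteq> f y\<rbrakk> \<Longrightarrow> \<exists>t\<in>f y. \<forall>x\<in>X. t \<in> f x \<longrightarrow> S \<subseteq> f x"
    and separated: "\<lbrakk>y \<in> Y; t \<in> T; t \<notin> f y\<rbrakk> \<Longrightarrow> \<exists>s\<in>f y. \<forall>x\<in>X. s \<in> f x \<longrightarrow> t \<notin> f x"
    and inj_limit: "inj_on f Y"
    and inj_isolated: "inj_on f (X - Y)"
    and image_isolated: "f ` (X - Y) \<subseteq> f ` Y"
begin

section \<open>The topology of the duplicate\<close>

definition cone :: "'n \<Rightarrow> 'x set"
  where "cone t = {x \<in> X. t \<in> f x}"

text \<open>Points outside \<open>Y\<close> carry no condition, hence are isolated. As the cone's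
  trace on \<open>Y\<close> must lie in \<open>U\<close>, the at most \<open>omega1\<close>
  exceptions are all isolated points.\<close>

definition dup_open :: "'x set \<Rightarrow> bool"
  where "dup_open U \<longleftrightarrow> U \<subseteq> X \<and>
    (\<forall>y\<in>U \<inter> Y. \<exists>t\<in>f y. cone t \<inter> Y \<subseteq> U \<and> |cone t - U| \<le>o omega1)"

definition dup_topology :: "'x topology"
  where "dup_topology = topology dup_open"

lemma dup_openD:
  "\<lbrakk>dup_open U; y \<in> U; y \<in> Y\<rbrakk> \<Longrightarrow> \<exists>t\<in>f y. cone t \<inter> Y \<subseteq> U \<and> |cone t - U| \<le>o omega1"
  unfolding dup_open_def by blast

lemma ex_node: "y \<in> Y \<Longrightarrow> \<exists>t. t \<in> f y"
  using bounded[of y "{}"] by auto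

text \<open>By \<open>bounded\<close>, one node lies beyond the countably many nodes chosen for the
  sets, and countably many exceptional sets have a union of size at most \<open>omega1\<close>. This
  serves both binary intersections and the P-space property; intersecting with \<open>X\<close>
  covers the empty family.\<close>

lemma dup_open_Inter_countable:
  assumes "countable \<U>" "\<And>U. U \<in> \<U> \<Longrightarrow> dup_open U"
  shows "dup_open (X \<inter> \<Inter>\<U>)"
  unfolding dup_open_def
proof (intro conjI ballI)
  fix y assume y: "y \<in> X \<inter> \<Inter>\<U> \<inter> Y"
  then have "\<forall>U\<in>\<U>. \<exists>t\<in>f y. cone t \<inter> Y \<subseteq> U \<and> |cone t - U| \<le>o omega1"
    using assms(2) unfolding dup_open_def by blast
  then obtain g where g: "\<forall>U\<in>\<U>. g U \<in> f y \<and> cone (g U) \<inter> Y \<subseteq> U \<and> |cone (g U) - U| \<le>o omega1"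
    by metis
  have "g ` \<U> \<subseteq> f y"
    using g by auto
  then obtain t where t: "t \<in> f y" "\<And>x. x \<in> X \<Longrightarrow> t \<in> f x \<Longrightarrow> g ` \<U> \<subseteq> f x"
    using bounded[OF _ countable_image[OF assms(1)]] y by (meson IntD2)
  have sub: "cone t \<subseteq> cone (g U)" if "U \<in> \<U>" for U
    using t(2) that by (auto simp: cone_def)
  have "|\<Union>U\<in>\<U>. cone (g U) - U| \<le>o omega1"
    by (rule UN_ordLeq_omega1) (use g assms(1) countable_ordLeq_omega1 in auto)
  moreover have "cone t - (X \<inter> \<Inter>\<U>) \<subseteq> (\<Union>U\<in>\<U>. cone (g U) - U)"
    using sub by (auto simp: cone_def)
  ultimately have "|cone t - (X \<inter> \<Inter>\<U>)| \<le>o omega1"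
    by (rule subset_ordLeq_omega1[rotated])
  moreover have "cone t \<inter> Y \<subseteq> X \<inter> \<Inter>\<U>"
    using sub g Y_subset by blast
  ultimately show "\<exists>t\<in>f y. cone t \<inter> Y \<subseteq> X \<inter> \<Inter>\<U> \<and> |cone t - (X \<inter> \<Inter>\<U>)| \<le>o omega1"
    using t(1) by blast
qed auto

lemma istopology_dup_open: "istopology dup_open"
  unfolding istopology_def
proof (intro conjI allI impI)
  fix U V assume "dup_open U" "dup_open V"
  moreover from this have "X \<inter> \<Inter>{U, V} = U \<inter> V"
    by (auto simp: dup_open_def)
  ultimately show "dup_open (U \<inter> V)"
    using dup_open_Inter_countable[of "{U, V}"] by auto
next
  fix \<U> assume \<U>: "\<forall>U\<in>\<U>. dup_open U"
  show "dup_open (\<Union>\<U>)"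
    unfolding dup_open_def
  proof (intro conjI ballI)
    fix y assume "y \<in> \<Union>\<U> \<inter> Y"
    then obtain U where U: "U \<in> \<U>" "y \<in> U" "y \<in> Y"
      by blast
    then obtain t where t: "t \<in> f y" "cone t \<inter> Y \<subseteq> U" "|cone t - U| \<le>o omega1"
      using \<U> dup_openD by blast
    have "cone t - \<Union>\<U> \<subseteq> cone t - U"
      using U by blast
    then have "|cone t - \<Union>\<U>| \<le>o omega1"
      using t(3) subset_ordLeq_omega1 by blast
    then show "\<exists>t\<in>f y. cone t \<inter> Y \<subseteq> \<Union>\<U> \<and> |cone t - \<Union>\<U>| \<le>o omega1"
      using t U by blast
  qed (use \<U> in \<open>auto simp: dup_open_def\<close>)
qed

lemma openin_dup: "openin dup_topology U \<longleftrightarrow> dup_open U"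
  by (simp add: dup_topology_def istopology_dup_open topology_inverse')

lemma topspace_dup: "topspace dup_topology = X"
proof -
  have "dup_open X"
    using dup_open_Inter_countable[of "{}"] by simp
  then show ?thesis
    unfolding topspace_def openin_dup by (auto simp: dup_open_def)
qed

lemma P_space_dup: "P_space dup_topology"
  unfolding P_space_def
proof (intro allI impI)
  fix S assume "gdelta_in dup_topology S"
  then obtain \<U> where "countable \<U>" "\<U> \<subseteq> Collect (openin dup_topology)" "S = X \<inter> \<Inter>\<U>"
    by (auto simp: gdelta_in_def relative_to_def intersection_of_def topspace_dup)
  then show "openin dup_topology S"
    using dup_open_Inter_countable[of \<U>] openin_dup by blast
qed

lemma dup_open_minus_small:
  assumes "F \<inter> Y = {}" "|F| \<le>o omega1"
  shows "dup_open (X - F)"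
  unfolding dup_open_def
proof (intro conjI ballI)
  fix y assume y: "y \<in> (X - F) \<inter> Y"
  then obtain t where "t \<in> f y"
    using ex_node by blast
  moreover have "|cone t - (X - F)| \<le>o omega1"
    by (rule subset_ordLeq_omega1[OF _ assms(2)]) (auto simp: cone_def)
  moreover have "cone t \<inter> Y \<subseteq> X - F"
    using assms(1) by (auto simp: cone_def)
  ultimately show "\<exists>t\<in>f y. cone t \<inter> Y \<subseteq> X - F \<and> |cone t - (X - F)| \<le>o omega1"
    by blast
qed auto

lemma dup_openI_cone:
  assumes "U \<subseteq> X" "\<And>y. y \<in> U \<inter> Y \<Longrightarrow> \<exists>t\<in>f y. cone t \<subseteq> U"
  shows "dup_open U"
  unfolding dup_open_def
proof (intro conjI ballI)
  fix y assume "y \<in> U \<inter> Y"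
  then obtain t where t: "t \<in> f y" "cone t \<subseteq> U"
    using assms(2) by blast
  then have "cone t - U = {}"
    by blast
  then show "\<exists>t\<in>f y. cone t \<inter> Y \<subseteq> U \<and> |cone t - U| \<le>o omega1"
    using t countable_ordLeq_omega1[of "{}"] by (metis countable_empty inf.coboundedI1)
qed (use assms in auto)

lemma dup_open_isolated: "x \<in> X - Y \<Longrightarrow> dup_open {x}"
  by (simp add: dup_open_def)

text \<open>Distinct branches are not nested: a node \<open>t\<close> of \<open>f y'\<close> outside
  \<open>f y\<close> is excluded by some \<open>s\<close> in \<open>f y\<close>, and
  \<open>s\<close> would also lie in \<open>f y'\<close> under inclusion.\<close>

lemma ex_node_diff:
  assumes "y \<in> Y" "y' \<in> Y" "y \<noteq> y'"
  shows "\<exists>t\<in>f y. t \<notin> f y'"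
proof (rule ccontr)
  assume *: "\<not> (\<exists>t\<in>f y. t \<notin> f y')"
  moreover have "f y \<noteq> f y'"
    using assms inj_limit by (auto simp: inj_on_def)
  ultimately obtain t where t: "t \<in> f y'" "t \<notin> f y"
    by blast
  then obtain s where "s \<in> f y" "\<forall>x\<in>X. s \<in> f x \<longrightarrow> t \<notin> f x"
    using separated[of y t] assms f_subset[of y'] Y_subset by blast
  then show False
    using * t assms Y_subset by blast
qed

lemma t1_space_dup: "t1_space dup_topology"
  unfolding t1_space_closedin_singleton topspace_dup
proof
  fix x assume x: "x \<in> X"
  have "dup_open (X - {x})"
  proof (cases "x \<in> Y")
    case True
    show ?thesis
    proof (rule dup_openI_cone)
      fix y assume "y \<in> (X - {x}) \<inter> Y"
      then show "\<exists>t\<in>f y. cone t \<subseteq> X - {x}"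
        using ex_node_diff[of y x] True by (auto simp: cone_def)
    qed auto
  next
    case False
    then show ?thesis
      by (intro dup_open_minus_small countable_ordLeq_omega1) auto
  qed
  then show "closedin dup_topology {x}"
    using x by (simp add: closedin_def topspace_dup openin_dup)
qed

text \<open>At a point of \<open>Y\<close> the set \<open>cone t \<inter> U\<close> works: its trace
  on \<open>Y\<close> is that of \<open>cone t\<close>, so any other point of \<open>Y\<close>
  misses \<open>t\<close> and has a cone disjoint from \<open>cone t\<close>. Regularity follows at
  once.\<close>

lemma ex_clopen_neighbourhood:
  assumes U: "dup_open U" and x: "x \<in> U"
  obtains V where "dup_open V" "dup_open (X - V)" "x \<in> V" "V \<subseteq> U"
proof (cases "x \<in> Y")
  case True
  then obtain t where t: "t \<in> f x" "cone t \<inter> Y \<subseteq> U" "|cone t - U| \<le>o omega1"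
    using dup_openD[OF U x] by blast
  have tT: "t \<in> T"
    using t(1) f_subset True Y_subset by blast
  have "cone t - (cone t \<inter> U) = cone t - U"
    by blast
  then have "dup_open (cone t \<inter> U)"
    using t unfolding dup_open_def by (auto simp: cone_def)
  moreover have "dup_open (X - cone t \<inter> U)"
  proof (rule dup_openI_cone)
    fix y assume y: "y \<in> (X - cone t \<inter> U) \<inter> Y"
    then have "t \<notin> f y"
      using t(2) by (auto simp: cone_def)
    then obtain s where "s \<in> f y" "\<forall>x\<in>X. s \<in> f x \<longrightarrow> t \<notin> f x"
      using separated y tT by blast
    then show "\<exists>s\<in>f y. cone s \<subseteq> X - cone t \<inter> U"
      by (auto simp: cone_def)
  qed auto
  moreover have "x \<in> cone t"
    using t(1) True Y_subset by (auto simp: cone_def)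
  ultimately show ?thesis
    using that[of "cone t \<inter> U"] x by blast
next
  case False
  then have "x \<in> X - Y"
    using U x by (auto simp: dup_open_def)
  then show ?thesis
    using that[of "{x}"] x dup_open_isolated
      dup_open_minus_small[of "{x}"] countable_ordLeq_omega1[of "{x}"] by auto
qed

lemma regular_space_dup: "regular_space dup_topology"
  unfolding regular_space_def
proof (intro allI impI)
  fix C x assume Cx: "closedin dup_topology C \<and> x \<in> topspace dup_topology - C"
  then have "dup_open (X - C)" "x \<in> X - C"
    by (auto simp: closedin_def topspace_dup openin_dup)
  then obtain V where "dup_open V" "dup_open (X - V)" "x \<in> V" "V \<subseteq> X - C"
    using ex_clopen_neighbourhood by blast
  moreover have "C \<subseteq> X - V"
    using calculation Cx closedin_subset topspace_dup by blast
  ultimately show "\<exists>U V. openin dup_topology U \<and> openin dup_topology V \<and> x \<in> U \<and> C \<subseteq> V \<and> disjnt U V"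
    unfolding openin_dup by (intro exI[of _ V] exI[of _ "X - V"]) (auto simp: disjnt_def)
qed

lemma Hausdorff_space_dup: "Hausdorff_space dup_topology"
  using regular_t1_imp_Hausdorff_space regular_space_dup t1_space_dup by blast

section \<open>Limit points of sets of isolated points\<close>

lemma two_limit_points:
  assumes F: "F \<subseteq> X - Y" and large: "\<not> |F| \<le>o omega1"
  obtains y z where "y \<in> Y" "z \<in> Y" "y \<noteq> z"
    "y \<in> dup_topology closure_of F" "z \<in> dup_topology closure_of F"
proof -
  \<comment> \<open>\<open>S\<close> collects the nodes whose cones meet \<open>F\<close> in a small
    set. Points of \<open>F\<close> outside \<open>G\<close> lie in one of these few small traces,
    so \<open>G\<close> is still large.\<close>
  define G where "G = {x \<in> F. \<forall>t\<in>f x. \<not> |cone t \<inter> F| \<le>o omega1}"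
  define S where "S = {t \<in> T. |cone t \<inter> F| \<le>o omega1}"
  have "|S| \<le>o omega1"
    by (rule subset_ordLeq_omega1[OF _ card_nodes]) (auto simp: S_def)
  then have "|\<Union>t\<in>S. cone t \<inter> F| \<le>o omega1"
    by (rule UN_ordLeq_omega1) (auto simp: S_def)
  moreover have "F - G \<subseteq> (\<Union>t\<in>S. cone t \<inter> F)"
  proof
    fix x assume x: "x \<in> F - G"
    then obtain t where "t \<in> f x" "|cone t \<inter> F| \<le>o omega1"
      by (auto simp: G_def)
    then show "x \<in> (\<Union>t\<in>S. cone t \<inter> F)"
      using x F f_subset[of x] by (auto simp: S_def cone_def)
  qed
  ultimately have small: "|F - G| \<le>o omega1"
    by (rule subset_ordLeq_omega1[rotated])
  have "\<not> |G| \<le>o omega1"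
    using Un_ordLeq_omega1[OF small] subset_ordLeq_omega1[of F "(F - G) \<union> G"] large by blast
  then have "infinite G"
    using countable_ordLeq_omega1 countable_finite by blast
  then obtain a where a: "a \<in> G"
    by (metis all_not_in_conv finite.emptyI)
  then obtain b where b: "b \<in> G" "a \<noteq> b"
    using \<open>infinite G\<close> by (metis finite.simps insertI1 subsetI subset_singletonD)
  \<comment> \<open>The twin of \<open>x\<close> in \<open>Y\<close> is a limit point: a
    neighbourhood omits only \<open>omega1\<close> points of some cone, which contains more points
    of \<open>F\<close> than that.\<close>
  have limit: "\<exists>y\<in>Y. f y = f x \<and> y \<in> dup_topology closure_of F" if x: "x \<in> G" for x
  proof -
    have "x \<in> X - Y"
      using x F by (auto simp: G_def)
    then obtain y where y: "y \<in> Y" "f y = f x"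
      using image_isolated by (metis image_iff subsetD)
    have "\<exists>z\<in>F. z \<in> U" if U: "dup_open U" "y \<in> U" for U
    proof (rule ccontr)
      assume none: "\<not> (\<exists>z\<in>F. z \<in> U)"
      obtain t where t: "t \<in> f x" "|cone t - U| \<le>o omega1"
        using dup_openD[OF U y(1)] y(2) by auto
      have "|cone t \<inter> F| \<le>o omega1"
        by (rule subset_ordLeq_omega1[OF _ t(2)]) (use none in auto)
      then show False
        using t(1) x by (auto simp: G_def)
    qed
    then have "y \<in> dup_topology closure_of F"
      using y Y_subset unfolding in_closure_of topspace_dup openin_dup by blast
    then show ?thesis
      using y by blast
  qed
  obtain y z where "y \<in> Y" "f y = f a" "y \<in> dup_topology closure_of F"
    "z \<in> Y" "f z = f b" "z \<in> dup_topology closure_of F"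
    using limit a b by metis
  moreover have "f a \<noteq> f b"
    using a b F inj_onD[OF inj_isolated, of a b] by (auto simp: G_def)
  ultimately show ?thesis
    using that by metis
qed

text \<open>The witness is \<open>X - Y\<close>. A small subset \<open>F\<close> is closed, so its
  closure adds no point; a large one gains at least two points of \<open>Y\<close>.\<close>

lemma not_weakly_Whyburn_dup:
  assumes large: "\<not> |X - Y| \<le>o omega1"
  shows "\<not> weakly_Whyburn dup_topology"
proof
  assume "weakly_Whyburn dup_topology"
  moreover have "\<not> closedin dup_topology (X - Y)"
  proof -
    obtain y where "y \<in> Y" "y \<in> dup_topology closure_of (X - Y)"
      using two_limit_points[OF subset_refl large] by metis
    then show ?thesis
      using closure_of_closedin by fastforce
  qed
  moreover have "X - Y \<subseteq> topspace dup_topology"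
    by (auto simp: topspace_dup)
  ultimately obtain x F where F: "F \<subseteq> X - Y" "dup_topology closure_of F - F = {x}"
    unfolding weakly_Whyburn_def almost_closed_converging_def by meson
  show False
  proof (cases "|F| \<le>o omega1")
    case True
    then have "dup_open (X - F)"
      using F by (intro dup_open_minus_small) auto
    then have "closedin dup_topology F"
      using F by (auto simp: closedin_def topspace_dup openin_dup)
    then show False
      using F(2) closure_of_closedin by fastforce
  next
    case False
    with F(1) obtain y z where "y \<in> Y" "z \<in> Y" "y \<noteq> z"
      "y \<in> dup_topology closure_of F" "z \<in> dup_topology closure_of F"
      using two_limit_points by blast
    moreover from this have "y \<notin> F" "z \<notin> F"
      using F(1) by auto
    ultimately show False
      using F(2) by (metis DiffI singletonD)
  qed
qed

end

section \<open>Branches of a tree\<close>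

lemma tree_branch_subset: "tree_branch T r b \<Longrightarrow> b \<subseteq> T"
  by (auto simp: tree_branch_def pred_on.maxchain_def pred_on.chain_def)

lemma tree_branch_comparable:
  "\<lbrakk>tree_branch T r b; s \<in> b; t \<in> b; s \<noteq> t\<rbrakk> \<Longrightarrow> (s, t) \<in> r \<or> (t, s) \<in> r"
  by (auto simp: tree_branch_def pred_on.maxchain_def pred_on.chain_def)

text \<open>Otherwise inserting \<open>t\<close> would properly extend a maximal chain.\<close>

lemma tree_branch_memI:
  assumes b: "tree_branch T r b" and "t \<in> T"
    and comparable: "\<And>s. s \<in> b \<Longrightarrow> s \<noteq> t \<Longrightarrow> (s, t) \<in> r \<or> (t, s) \<in> r"
  shows "t \<in> b"
proof (rule ccontr)
  assume "t \<notin> b"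
  have "pred_on.chain T (\<lambda>s t. (s, t) \<in> r) (insert t b)"
    using assms tree_branch_subset[OF b] tree_branch_comparable[OF b]
    by (auto simp: pred_on.chain_def)
  then show False
    using b \<open>t \<notin> b\<close> by (auto simp: tree_branch_def pred_on.maxchain_def)
qed

text \<open>An element of \<open>b\<close> above \<open>t\<close> is above \<open>s\<close> by
  transitivity; one below \<open>t\<close> is comparable with \<open>s\<close> because the
  predecessors of \<open>t\<close> are well-ordered.\<close>

lemma tree_branch_downward_closed:
  assumes T: "tree_order T r" and b: "tree_branch T r b" and t: "t \<in> b" and st: "(s, t) \<in> r"
  shows "s \<in> b"
proof (rule tree_branch_memI[OF b])
  have po: "trans r" "r \<subseteq> T \<times> T"
    using T by (auto simp: tree_order_def partial_order_on_def preorder_on_def refl_on_def)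
  show "s \<in> T"
    using po st by blast
  fix u assume u: "u \<in> b" "u \<noteq> s"
  show "(u, s) \<in> r \<or> (s, u) \<in> r"
  proof (cases "(t, u) \<in> r \<or> s = t \<or> u = t")
    case True
    then show ?thesis
      using st po u t tree_branch_comparable[OF b, of u s] by (meson transD)
  next
    case False
    then have "(u, t) \<in> r"
      using tree_branch_comparable[OF b u(1) t] by blast
    then have "s \<in> underS r t" "u \<in> underS r t"
      using st False by (auto simp: underS_def)
    moreover have "total_on (underS r t) (Restr r (underS r t))"
      using T t tree_branch_subset[OF b]
      by (auto simp: tree_order_def well_order_on_def linear_order_on_def)
    ultimately show ?thesis
      using u(2) by (auto simp: total_on_def)
  qed
qed

text \<open>Nodes have countable height, so the elements of \<open>S\<close> and their predecessors
  form a countable set. A node of \<open>b\<close> outside it is comparable with each element of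
  \<open>S\<close>, hence above it.\<close>

lemma uncountable_branch_bounded:
  assumes T: "weak_Kurepa_tree T r" and b: "tree_branch T r b" "uncountable b"
    and S: "countable S" "S \<subseteq> b"
  obtains t where "t \<in> b" "\<And>s. s \<in> S \<Longrightarrow> (s, t) \<in> r"
proof -
  have "countable (\<Union>s\<in>S. insert s (underS r s))"
    using T S tree_branch_subset[OF b(1)]
    by (intro countable_UN countable_insert) (auto simp: weak_Kurepa_tree_def)
  then obtain t where t: "t \<in> b" "t \<notin> (\<Union>s\<in>S. insert s (underS r s))"
    using b(2) by (metis countable_subset subsetI)
  have "(s, t) \<in> r" if "s \<in> S" for s
    using tree_branch_comparable[OF b(1), of s t] t S that by (auto simp: underS_def)
  then show ?thesis
    using that t by blast
qed

text \<open>An infinite \<open>B\<close> is equinumerous with \<open>B <+> B\<close>, so two copies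
  of \<open>B\<close> fit inside \<open>B\<close> itself and the space needs no new type.\<close>

lemma infinite_two_to_one:
  assumes "infinite B"
  obtains Y f where "Y \<subseteq> B" "bij_betw f Y B" "bij_betw f (B - Y) B"
proof -
  have "|B <+> B| =o |B|"
    using card_of_Plus_infinite1[OF assms ordLeq_refl[OF card_of_Card_order]] .
  then obtain g where g: "bij_betw g (B <+> B) B"
    using card_of_ordIso by blast
  \<comment> \<open>Undo the pairing \<open>g\<close>, then forget the tag of the sum.\<close>
  define f where "f = case_sum id id \<circ> the_inv_into (B <+> B) g"
  have inj: "inj_on g (B <+> B)" and img: "g ` (B <+> B) = B"
    using g by (auto simp: bij_betw_def)
  have f: "f (g (Inl x)) = x" "f (g (Inr x)) = x" if "x \<in> B" for x
    by (simp_all add: f_def the_inv_into_f_f[OF inj] InlI[OF that] InrI[OF that])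
  have "g ` (B <+> B - Inl ` B) = B - g ` Inl ` B"
    using inj_on_image_set_diff[OF inj, of "B <+> B" "Inl ` B"] img by (auto simp: Plus_def)
  moreover have "B <+> B - Inl ` B = Inr ` B"
    by auto
  ultimately have diff: "B - g ` Inl ` B = g ` Inr ` B"
    by simp
  show ?thesis
  proof
    show "g ` Inl ` B \<subseteq> B"
      using img by auto
    show "bij_betw f (g ` Inl ` B) B"
      by (rule bij_betw_imageI) (auto simp: inj_on_def f image_image)
    show "bij_betw f (B - g ` Inl ` B) B"
      unfolding diff by (rule bij_betw_imageI) (auto simp: inj_on_def f image_image)
  qed
qed

section \<open>The space of a weak Kurepa tree\<close>

lemma branch_duplicate_of_weak_Kurepa_tree:
  assumes T: "weak_Kurepa_tree T r"
    and B: "\<And>b. b \<in> B \<Longrightarrow> tree_branch T r b \<and> uncountable b"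
    and f: "Y \<subseteq> X" "bij_betw f Y B" "bij_betw f (X - Y) B"
  shows "branch_duplicate X Y T f"
proof
  have order: "tree_order T r"
    using T by (simp add: weak_Kurepa_tree_def)
  have br: "tree_branch T r (f x)" "uncountable (f x)" if "x \<in> X" for x
    using B f(2,3) that by (metis DiffI bij_betwE)+
  show "|T| \<le>o omega1"
    using T by (simp add: weak_Kurepa_tree_def ordIso_iff_ordLeq)
  show "f x \<subseteq> T" if "x \<in> X" for x
    using br that tree_branch_subset by blast
  show "\<exists>t\<in>f y. \<forall>x\<in>X. t \<in> f x \<longrightarrow> S \<subseteq> f x" if S: "y \<in> Y" "countable S" "S \<subseteq> f y" for y S
  proof -
    obtain t where t: "t \<in> f y" "\<And>s. s \<in> S \<Longrightarrow> (s, t) \<in> r"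
      using uncountable_branch_bounded[OF T br S(2,3)] S(1) f(1) by blast
    \<comment> \<open>A branch through the upper bound \<open>t\<close> contains all of
      \<open>S\<close> by downward closure.\<close>
    then show ?thesis
      using tree_branch_downward_closed[OF order br(1)] by blast
  qed
  show "\<exists>s\<in>f y. \<forall>x\<in>X. s \<in> f x \<longrightarrow> t \<notin> f x" if t: "y \<in> Y" "t \<in> T" "t \<notin> f y" for y t
  proof -
    have y: "tree_branch T r (f y)"
      using br t(1) f(1) by blast
    \<comment> \<open>By maximality of \<open>f y\<close>, the missing node \<open>t\<close> is
      incomparable with some \<open>s\<close> in it, so no branch contains both.\<close>
    then obtain s where "s \<in> f y" "s \<noteq> t" "(s, t) \<notin> r" "(t, s) \<notin> r"
      using tree_branch_memI[OF y t(2)] t(3) by blast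
    then show ?thesis
      using tree_branch_comparable[OF br(1)] by blast
  qed
qed (use f in \<open>auto simp: bij_betw_def\<close>)

theorem mainTheorem3:
  assumes wKH: "\<exists>(T :: 'a set) (r :: 'a rel). weak_Kurepa_tree T r"
  shows "\<exists>X :: 'a set topology.
    regular_space X \<and> Hausdorff_space X \<and> P_space X \<and>
    |topspace X| =o omega2 \<and> \<not> weakly_Whyburn X"
proof -
  obtain T :: "'a set" and r where T: "weak_Kurepa_tree T r"
    using wKH by blast
  have co: "Card_order omega2"
    by (simp add: cardSuc_Card_order Card_order_omega1)
  \<comment> \<open>There may be more than \<open>omega2\<close> uncountable branches; a subfamily
    \<open>B\<close> of exactly that size is chosen to fix the cardinality of the space.\<close>
  have "|Field omega2| \<le>o |{b. tree_branch T r b \<and> uncountable b}|"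
    using T card_of_Field_ordIso[OF co] ordIso_ordLeq_trans by (auto simp: weak_Kurepa_tree_def)
  then obtain B where B: "B \<subseteq> {b. tree_branch T r b \<and> uncountable b}" "|Field omega2| =o |B|"
    using internalize_card_of_ordLeq2 by blast
  have B_card: "|B| =o omega2"
    using B(2) card_of_Field_ordIso[OF co] ordIso_symmetric ordIso_transitive by blast
  have B_large: "\<not> |B| \<le>o omega1"
    using B_card cardSuc_greater[OF Card_order_omega1] not_ordLess_ordLeq ordIso_iff_ordLeq
      ordLeq_transitive by blast
  then have "infinite B"
    using countable_ordLeq_omega1 countable_finite by blast
  then obtain Y f where f: "Y \<subseteq> B" "bij_betw f Y B" "bij_betw f (B - Y) B"
    using infinite_two_to_one by blast
  interpret branch_duplicate B Y T f
    by (rule branch_duplicate_of_weak_Kurepa_tree[OF T _ f]) (use B in auto)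
  \<comment> \<open>The isolated half is as large as \<open>B\<close>, hence exceeds
    \<open>omega1\<close>.\<close>
  have "|B - Y| =o |B|"
    using f(3) card_of_ordIso by blast
  then have "\<not> |B - Y| \<le>o omega1"
    using B_large ordIso_ordLeq_trans ordIso_symmetric by blast
  then show ?thesis
    using regular_space_dup Hausdorff_space_dup P_space_dup not_weakly_Whyburn_dup B_card
    by (intro exI[of _ dup_topology]) (simp add: topspace_dup)
qed

end
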